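(* Suppose there exist constants $u_*\ge0$, $c_*>0$, $L_2>0$ such that (a) $U(u,t)\ge u+c_*t$ for all $u\ge u_*$, $t\ge 0$, and (b) $$\int_0^{+\infty}e^{L_2z}\,dF(z)\int_0^\infty e^{-c_*L_2t}(1-K_p(t))\,dK_c(t)+\int_0^{+\infty}e^{-L_2z}\,dG(z)\int_0^\infty e^{-c_*L_2t}(1-K_c(t))\,dK_p(t)\le1,$$ and $\lim_{z\to\infty}e^{L_2z}(1-F(z))=0$. Let $\varphi_*(u)=\max\{0,1-e^{-L_2(u-u_* )}\}$. Then $\varphi_*$ is a nondecreasing function with $0\le\varphi_*(u)\le1$ and $\lim_{u\to+\infty}\varphi_*(u)=1$, and $A_2\varphi_*(u)\ge\varphi_*(u)$ for all $u\ge0$.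
   Context: $F$ and $G$ are distribution functions of nonnegative random variables (claims and premiums). $c:[0,+\infty)\to[0,+\infty)$ is piecewise continuous and $U(u,t)$ is the solution of the Cauchy problem $dU/dt=c(U)$, $U(u,0)=u$, assumed well defined for all $u,t\ge0$; it is nondecreasing in $u$. $K_p,K_c$ are distribution functions of nonnegative random variables with no common discontinuity points and with $K_p(t)<1$, $K_c(t)<1$ for all $t\ge0$. For a bounded Borel function $\varphi$ on $[0,+\infty)$ and $u\ge0$, $$A_2\varphi(u)=\int_0^\infty\!\int_0^{U(u,t)}\varphi(U(u,t)-z)\,dF(z)(1-K_p(t))\,dK_c(t)+\int_0^\infty\!\int_0^{+\infty}\varphi(U(u,t)+z)\,dG(z)(1-K_c(t))\,dK_p(t),$$ with Lebesgue–Stieltjes integrals, endpoints included. *)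

theory Defs
  imports "HOL-Probability.Probability"
begin

definition nonneg_cdf :: "(real \<Rightarrow> real) \<Rightarrow> bool" where
  "nonneg_cdf F \<longleftrightarrow> (\<exists>M. real_distribution M \<and> (AE x in M. 0 \<le> x) \<and> F = cdf M)"

definition piecewise_continuous :: "(real \<Rightarrow> real) \<Rightarrow> bool" where
  "piecewise_continuous c \<longleftrightarrow>
     (\<forall>b. finite {x \<in> {0..b}. \<not> continuous (at x within {0..}) c}) \<and>
     (\<forall>x\<ge>0. \<exists>l. (c \<longlongrightarrow> l) (at_right x)) \<and>
     (\<forall>x>0. \<exists>l. (c \<longlongrightarrow> l) (at_left x))"

text \<open>
  At a time at which \<open>y\<close> crosses a jump of \<open>c\<close> the derivative need not exist, so the
  equation is required off a set of times having finitely many points in each bounded interval.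
\<close>

definition cauchy_solution :: "(real \<Rightarrow> real) \<Rightarrow> real \<Rightarrow> (real \<Rightarrow> real) \<Rightarrow> bool" where
  "cauchy_solution c u y \<longleftrightarrow>
     y 0 = u \<and> (\<forall>t\<ge>0. 0 \<le> y t) \<and> continuous_on {0..} y \<and>
     (\<exists>S. (\<forall>b. finite (S \<inter> {0..b})) \<and>
          (\<forall>t\<in>{0..} - S. (y has_real_derivative c (y t)) (at t within {0..})))"

definition cauchy_flow :: "(real \<Rightarrow> real) \<Rightarrow> (real \<Rightarrow> real \<Rightarrow> real) \<Rightarrow> bool" where
  "cauchy_flow c U \<longleftrightarrow>
     (\<forall>u\<ge>0. cauchy_solution c u (U u) \<and>
            (\<forall>y. cauchy_solution c u y \<longrightarrow> (\<forall>t\<ge>0. y t = U u t)))"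

definition A2 ::
  "(real \<Rightarrow> real) \<Rightarrow> (real \<Rightarrow> real) \<Rightarrow> (real \<Rightarrow> real) \<Rightarrow> (real \<Rightarrow> real) \<Rightarrow>
   (real \<Rightarrow> real \<Rightarrow> real) \<Rightarrow> (real \<Rightarrow> real) \<Rightarrow> real \<Rightarrow> real" where
  "A2 F G Kp Kc U \<phi> u =
     (LINT t:{0..}|interval_measure Kc.
        (LINT z:{0..U u t}|interval_measure F. \<phi> (U u t - z)) * (1 - Kp t)) +
     (LINT t:{0..}|interval_measure Kp.
        (LINT z:{0..}|interval_measure G. \<phi> (U u t + z)) * (1 - Kc t))"

definition phi_star :: "real \<Rightarrow> real \<Rightarrow> real \<Rightarrow> real" where
  "phi_star L u0 u = max 0 (1 - exp (- L * (u - u0)))"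

lemma cauchy_solution_shift:
  assumes "cauchy_solution c u y" "s \<ge> 0"
  shows "cauchy_solution c (y s) (\<lambda>t. y (s + t))"
proof -
  from assms(1) obtain S where S: "\<And>b. finite (S \<inter> {0..b})"
    and D: "\<And>t. t \<ge> 0 \<Longrightarrow> t \<notin> S \<Longrightarrow> (y has_real_derivative c (y t)) (at t within {0..})"
    and nn: "\<And>t. t \<ge> 0 \<Longrightarrow> y t \<ge> 0" and co: "continuous_on {0..} y"
    unfolding cauchy_solution_def by auto
  let ?S = "{t. s + t \<in> S}"
  have fin: "finite (?S \<inter> {0..b})" for b
  proof -
    have "?S \<inter> {0..b} \<subseteq> (\<lambda>x. x - s) ` (S \<inter> {0..s + b})"
    proof
      fix t assume "t \<in> ?S \<inter> {0..b}"
      then show "t \<in> (\<lambda>x. x - s) ` (S \<inter> {0..s + b})"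
        using assms(2) by (intro image_eqI[of _ _ "s + t"]) auto
    qed
    then show ?thesis using S finite_subset by blast
  qed
  have der: "((\<lambda>t. y (s + t)) has_real_derivative c (y (s + t))) (at t within {0..})"
    if "t \<in> {0..} - ?S" for t
  proof -
    have "(y has_real_derivative c (y (s + t))) (at (s + t) within (+) s ` {0..})"
      using that assms(2) by (intro DERIV_subset[OF D]) auto
    then show ?thesis by (simp only: DERIV_at_within_shift)
  qed
  have "continuous_on {0..} (\<lambda>t. y (s + t))"
    using assms(2) by (intro continuous_on_compose2[OF co] continuous_intros) auto
  then show ?thesis
    unfolding cauchy_solution_def using nn assms(2) fin der by auto
qed

lemma cauchy_flow_mono:
  assumes fl: "cauchy_flow c U" and u: "0 \<le> u" "u \<le> v" and t: "0 \<le> t"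
  shows "U u t \<le> U v t"
proof (rule ccontr)
  assume less: "\<not> U u t \<le> U v t"
  have su: "cauchy_solution c u (U u)" and sv: "cauchy_solution c v (U v)"
    using fl u unfolding cauchy_flow_def by auto
  have "continuous_on {0..t} (\<lambda>x. U u x - U v x)"
    using su sv unfolding cauchy_solution_def
    by (intro continuous_intros) (auto elim: continuous_on_subset)
  moreover have "U u 0 - U v 0 \<le> 0" using su sv u unfolding cauchy_solution_def by auto
  ultimately obtain s where s: "0 \<le> s" "s \<le> t" "U u s - U v s = 0"
    using IVT'[of "\<lambda>x. U u x - U v x" 0 0 t] less t by auto
  have "U u s \<ge> 0" using su s unfolding cauchy_solution_def by auto
  then have uniq: "\<And>y r. cauchy_solution c (U u s) y \<Longrightarrow> r \<ge> 0 \<Longrightarrow> y r = U (U u s) r"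
    using fl unfolding cauchy_flow_def by auto
  have "U u (s + (t - s)) = U (U u s) (t - s)"
    using uniq[OF cauchy_solution_shift[OF su s(1)], of "t - s"] s by simp
  moreover have "U v (s + (t - s)) = U (U u s) (t - s)"
    using uniq[of "\<lambda>r. U v (s + r)" "t - s"] cauchy_solution_shift[OF sv s(1)] s by simp
  ultimately show False using less by simp
qed

end

theory Submission
  imports Defs
begin

text \<open>
  For \<open>u \<ge> u\<^sub>*\<close> the function \<open>1 - exp (- L (v - u\<^sub>*))\<close> is a minorant of \<open>\<phi>\<^sub>*\<close> that is negative
  for \<open>v < 0\<close>, so the truncation at ruin may be dropped, and the inner integrals are at least
  \<open>1 - exp (- L (u - u\<^sub>*)) exp (- c\<^sub>* L t) E\<close> with \<open>E\<close> the respective exponential moment.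
  Integrating over \<open>t\<close>, the constant parts add up to the probability that a claim and a premium do
  not arrive simultaneously, which is \<open>1\<close> in the absence of common atoms, while hypothesis (b)
  bounds the rest by \<open>exp (- L (u - u\<^sub>*))\<close>. The moment of \<open>F\<close> is finite because its cofactor in
  (b) is positive.
\<close>

section \<open>Stieltjes measures of distribution functions on the half-line\<close>

text \<open>A distribution on the line is determined by its distribution function, so
  \<open>interval_measure F\<close> is the very measure whose existence \<open>nonneg_cdf\<close>
  asserts and inherits its support.\<close>

lemma nonneg_cdf_interval_measure:
  assumes "nonneg_cdf F"
  shows "real_distribution (interval_measure F)"
    and "AE x in interval_measure F. 0 \<le> x"
    and "cdf (interval_measure F) = F"
proof -
  from assms obtain M where M: "real_distribution M" "AE x in M. 0 \<le> x" "F = cdf M"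
    unfolding nonneg_cdf_def by blast
  interpret M: real_distribution M by fact
  have I: "real_distribution (interval_measure (cdf M))" "cdf (interval_measure (cdf M)) = cdf M"
    using M.cdf_nondecreasing M.cdf_is_right_cont M.cdf_lim_at_bot M.cdf_lim_at_top_prob
    by (auto intro!: real_distribution_interval_measure cdf_interval_measure)
  have eq: "interval_measure F = M"
    unfolding M(3) using I M(1) by (intro cdf_unique) auto
  then show "real_distribution (interval_measure F)" "AE x in interval_measure F. 0 \<le> x"
    "cdf (interval_measure F) = F"
    unfolding eq using M by auto
qed

lemma (in real_distribution) borel_measurable_cdf [measurable]: "cdf M \<in> borel_measurable borel"
  by (intro borel_measurable_mono monoI cdf_nondecreasing)

lemma (in real_distribution) emeasure_greaterThan: "emeasure M {x<..} = ennreal (1 - cdf M x)"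
proof -
  have "{x<..} = space M - {..x}" by auto
  then have "prob {x<..} = 1 - cdf M x"
    unfolding cdf_def by (simp only:) (subst prob_compl, auto)
  then show ?thesis by (simp add: emeasure_eq_measure)
qed

lemma AE_set_lebesgue_integral_eq:
  fixes f :: "'a \<Rightarrow> real"
  assumes "AE x in M. x \<in> A" "A \<in> sets M" "f \<in> borel_measurable M"
  shows "(LINT x:A|M. f x) = (LINT x|M. f x)"
  unfolding set_lebesgue_integral_def using assms
  by (intro integral_cong_AE) auto

section \<open>Ties between claim and premium arrival times\<close>

text \<open>For independent times with laws \<open>P\<close> and \<open>Q\<close>, the first
  integral is the probability that the \<open>Q\<close> time comes strictly first, the second that
  the \<open>P\<close> time does. They exhaust the product space up to the diagonal, which is
  null.\<close>

lemma real_distribution_no_ties: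
  assumes P: "real_distribution P" "AE x in P. 0 \<le> x"
    and Q: "real_distribution Q" "AE x in Q. 0 \<le> x"
    and no_common_atom: "\<And>t. isCont (cdf P) t \<or> isCont (cdf Q) t"
  shows "(LINT t:{0..}|Q. 1 - cdf P t) + (LINT t:{0..}|P. 1 - cdf Q t) = 1"
proof -
  interpret P: real_distribution P by fact
  interpret Q: real_distribution Q by fact
  interpret PQ: pair_prob_space P Q ..
  have sets_eq: "sets (P \<Otimes>\<^sub>M Q) = sets (borel \<Otimes>\<^sub>M borel)"
    by (intro sets_pair_measure_cong) auto
  have sp: "space (P \<Otimes>\<^sub>M Q) = UNIV" by (simp add: space_pair_measure)
  let ?lt = "{x::real\<times>real. fst x < snd x}"
    and ?gt = "{x::real\<times>real. snd x < fst x}"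
    and ?eq = "{x::real\<times>real. fst x = snd x}"
  have "?lt \<in> sets (borel \<Otimes>\<^sub>M borel)" "?gt \<in> sets (borel \<Otimes>\<^sub>M borel)"
    "?eq \<in> sets (borel \<Otimes>\<^sub>M borel)"
    unfolding borel_prod
    by (intro borel_open open_Collect_less borel_closed[OF closed_Collect_eq] continuous_intros)+
  then have meas: "?lt \<in> sets (P \<Otimes>\<^sub>M Q)" "?gt \<in> sets (P \<Otimes>\<^sub>M Q)" "?eq \<in> sets (P \<Otimes>\<^sub>M Q)"
    by (simp_all only: sets_eq)
  \<comment> \<open>By Fubini the diagonal has the \<open>P\<close>-average of the point masses of
    \<open>Q\<close>. These are nonzero at only countably many points, and each such point is
    \<open>P\<close>-null because atoms are not shared.\<close>
  have "emeasure (P \<Otimes>\<^sub>M Q) ?eq = (\<integral>\<^sup>+x. emeasure Q {x} \<partial>P)"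
    by (subst Q.emeasure_pair_measure_alt[OF meas(3)]) (auto intro!: nn_integral_cong arg_cong[where f="emeasure Q"])
  also have "\<dots> = (\<integral>\<^sup>+x. 0 \<partial>P)"
  proof (rule nn_integral_cong_AE)
    have "{x. Q.prob {x} > 0} = (\<Union>x\<in>{x. Q.prob {x} > 0}. {x})" by auto
    moreover have "(\<Union>x\<in>{x. Q.prob {x} > 0}. {x}) \<in> null_sets P"
    proof (rule null_sets_UN'[OF Q.countable_atoms])
      fix x assume "x \<in> {x. Q.prob {x} > 0}"
      then have "P.prob {x} = 0"
        using no_common_atom[of x] P.isCont_cdf[of x] Q.isCont_cdf[of x] by auto
      then show "{x} \<in> null_sets P"
        by (intro null_setsI) (simp_all add: P.emeasure_eq_measure)
    qed
    ultimately have "{x. Q.prob {x} > 0} \<in> null_sets P" by simp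
    from AE_not_in[OF this] show "AE x in P. emeasure Q {x} = 0"
      by eventually_elim (simp add: Q.emeasure_eq_measure zero_less_measure_iff)
  qed
  finally have eq0: "measure (P \<Otimes>\<^sub>M Q) ?eq = 0"
    by (simp add: measure_def)
  have int: "integrable P (\<lambda>t. 1 - cdf Q t)" "integrable Q (\<lambda>t. 1 - cdf P t)"
    using P.cdf_bounded_prob P.cdf_nonneg Q.cdf_bounded_prob Q.cdf_nonneg
    by (auto intro!: P.integrable_const_bound[where B=1] Q.integrable_const_bound[where B=1])
  \<comment> \<open>The slice of \<open>?lt\<close> at first coordinate \<open>x\<close> is
    \<open>{x<..}\<close>, of \<open>Q\<close>-mass \<open>1 - cdf Q x\<close>; \<open>?gt\<close>
    is sliced along the second coordinate instead.\<close>
  have "emeasure (P \<Otimes>\<^sub>M Q) ?lt = (\<integral>\<^sup>+x. ennreal (1 - cdf Q x) \<partial>P)"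
    by (subst Q.emeasure_pair_measure_alt[OF meas(1)])
      (auto intro!: nn_integral_cong arg_cong[where f="emeasure Q"]
        simp flip: Q.emeasure_greaterThan)
  also have "\<dots> = ennreal (LINT t|P. 1 - cdf Q t)"
    using int Q.cdf_bounded_prob by (intro nn_integral_eq_integral) auto
  finally have lt: "measure (P \<Otimes>\<^sub>M Q) ?lt = (LINT t|P. 1 - cdf Q t)"
    using Q.cdf_bounded_prob by (simp add: measure_def integral_nonneg_AE)
  have "emeasure (P \<Otimes>\<^sub>M Q) ?gt = (\<integral>\<^sup>+x. ennreal (1 - cdf P x) \<partial>Q)"
    by (subst PQ.emeasure_pair_measure_alt2[OF meas(2)])
      (auto intro!: nn_integral_cong arg_cong[where f="emeasure P"]
        simp flip: P.emeasure_greaterThan)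
  also have "\<dots> = ennreal (LINT t|Q. 1 - cdf P t)"
    using int P.cdf_bounded_prob by (intro nn_integral_eq_integral) auto
  finally have gt: "measure (P \<Otimes>\<^sub>M Q) ?gt = (LINT t|Q. 1 - cdf P t)"
    using P.cdf_bounded_prob by (simp add: measure_def integral_nonneg_AE)
  have "1 = measure (P \<Otimes>\<^sub>M Q) (?lt \<union> ?gt \<union> ?eq)"
  proof -
    have "?lt \<union> ?gt \<union> ?eq = space (P \<Otimes>\<^sub>M Q)" by (auto simp: sp)
    then show ?thesis by (simp only: PQ.prob_space)
  qed
  also have "\<dots> = measure (P \<Otimes>\<^sub>M Q) ?lt + measure (P \<Otimes>\<^sub>M Q) ?gt + measure (P \<Otimes>\<^sub>M Q) ?eq"
    using meas by (subst PQ.finite_measure_Union, auto)+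
  finally show ?thesis
    using P(2) Q(2) by (simp add: lt gt eq0 AE_set_lebesgue_integral_eq)
qed

section \<open>The function \<open>phi_star\<close> and its exponential minorant\<close>

lemma phi_star_nonneg: "0 \<le> phi_star L u0 u"
  and phi_star_le_1: "phi_star L u0 u \<le> 1"
  and phi_star_ge: "1 - exp (- L * (u - u0)) \<le> phi_star L u0 u"
  by (auto simp: phi_star_def)

lemma borel_measurable_phi_star [measurable]: "phi_star L u0 \<in> borel_measurable borel"
  unfolding phi_star_def by measurable

lemma mono_phi_star:
  assumes "L \<ge> 0"
  shows "mono (phi_star L u0)"
  using assms unfolding phi_star_def
  by (intro monoI max.mono) (auto simp: mult_left_mono)

lemma tendsto_phi_star:
  assumes "L > 0"
  shows "(phi_star L u0 \<longlongrightarrow> 1) at_top"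
proof -
  have "filterlim (\<lambda>u. - L * (u - u0)) at_bot at_top"
    using assms by real_asymp
  then have "((\<lambda>u. exp (- L * (u - u0))) \<longlongrightarrow> 0) at_top"
    by (rule filterlim_compose[OF exp_at_bot])
  then have "((\<lambda>u. max 0 (1 - exp (- L * (u - u0)))) \<longlongrightarrow> max 0 (1 - 0)) at_top"
    by (intro tendsto_intros)
  then show ?thesis by (simp add: phi_star_def[abs_def])
qed

section \<open>Lower bounds for the inner and outer integrals\<close>

lemma (in real_distribution) claim_integral_lower_bound:
  assumes nn: "AE z in M. 0 \<le> z"
    and int: "set_integrable M {0..} (\<lambda>z. exp (L * z))"
    and "L \<ge> 0" "0 \<le> u0" "u0 \<le> x"
  shows "1 - exp (- L * (x - u0)) * (LINT z:{0..}|M. exp (L * z))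
    \<le> (LINT z:{0..x}|M. phi_star L u0 (x - z))"
proof -
  have "1 - exp (- L * (x - u0)) * (LINT z:{0..}|M. exp (L * z))
    = (LINT z|M. 1 - exp (- L * (x - u0)) * (indicator {0..} z * exp (L * z)))"
    using int unfolding set_integrable_def set_lebesgue_integral_def
    by (simp add: prob_space[simplified])
  also have "\<dots> \<le> (LINT z|M. indicator {0..x} z * phi_star L u0 (x - z))"
  proof (rule integral_mono_AE)
    show "integrable M (\<lambda>z. 1 - exp (- L * (x - u0)) * (indicator {0..} z * exp (L * z)))"
      using int unfolding set_integrable_def by simp
    show "integrable M (\<lambda>z. indicator {0..x} z * phi_star L u0 (x - z))"
      using phi_star_nonneg phi_star_le_1
      by (intro integrable_const_bound[where B=1]) (auto simp: indicator_def)
    show "AE z in M. 1 - exp (- L * (x - u0)) * (indicator {0..} z * exp (L * z))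
      \<le> indicator {0..x} z * phi_star L u0 (x - z)"
      using nn
    proof eventually_elim
      case (elim z)
      have e: "exp (- L * (x - u0)) * exp (L * z) = exp (- L * (x - z - u0))"
        by (simp add: exp_add[symmetric] algebra_simps)
      show ?case
      proof (cases "z \<le> x")
        case True
        then show ?thesis using elim phi_star_ge[of L "x - z" u0] e by simp
      next
        \<comment> \<open>Ruin occurs: the right side is 0, and since \<open>u0\<close> is
          nonnegative, \<open>x - z - u0\<close> is negative. The exponential is then at least 1, so
          the minorant is at most 0.\<close>
        case False
        then have "0 \<le> - L * (x - z - u0)"
          using assms by (simp add: mult_nonneg_nonpos)
        then show ?thesis using elim False e by simp
      qed
    qed
  qed
  finally show ?thesis by (simp add: set_lebesgue_integral_def)
qed

lemma (in real_distribution) premium_integral_lower_bound: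
  assumes nn: "AE z in M. 0 \<le> z" and "L \<ge> 0"
  shows "1 - exp (- L * (x - u0)) * (LINT z:{0..}|M. exp (- L * z))
    \<le> (LINT z:{0..}|M. phi_star L u0 (x + z))"
proof -
  \<comment> \<open>Unlike the claim moment, this exponential is at most 1 on the half-line, so its
    integrability is automatic.\<close>
  have int: "integrable M (\<lambda>z. indicator {0..} z * exp (- L * z))"
    using \<open>L \<ge> 0\<close> by (intro integrable_const_bound[where B=1]) (auto simp: indicator_def)
  have "1 - exp (- L * (x - u0)) * (LINT z:{0..}|M. exp (- L * z))
    = (LINT z|M. 1 - exp (- L * (x - u0)) * (indicator {0..} z * exp (- L * z)))"
    using int unfolding set_lebesgue_integral_def
    by (simp add: prob_space[simplified])
  also have "\<dots> \<le> (LINT z|M. indicator {0..} z * phi_star L u0 (x + z))"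
  proof (rule integral_mono_AE)
    show "integrable M (\<lambda>z. 1 - exp (- L * (x - u0)) * (indicator {0..} z * exp (- L * z)))"
      using int by simp
    show "integrable M (\<lambda>z. indicator {0..} z * phi_star L u0 (x + z))"
      using phi_star_nonneg phi_star_le_1
      by (intro integrable_const_bound[where B=1]) (auto simp: indicator_def)
    show "AE z in M. 1 - exp (- L * (x - u0)) * (indicator {0..} z * exp (- L * z))
      \<le> indicator {0..} z * phi_star L u0 (x + z)"
      using nn
    proof eventually_elim
      case (elim z)
      have "exp (- L * (x - u0)) * exp (- L * z) = exp (- L * (x + z - u0))"
        by (simp add: exp_add[symmetric] algebra_simps)
      then show ?case using elim phi_star_ge[of L "x + z" u0] by simp
    qed
  qed
  finally show ?thesis by (simp add: set_lebesgue_integral_def)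
qed

text \<open>Bounds the inner integrals of \<open>A2\<close>. A function that is not integrable has
  integral 0 by convention, which also satisfies the bound.\<close>

lemma (in real_distribution) integral_abs_le_1:
  assumes "\<And>z. \<bar>f z\<bar> \<le> (1::real)"
  shows "\<bar>LINT z|M. f z\<bar> \<le> 1"
proof (cases "integrable M f")
  case True
  have "\<bar>LINT z|M. f z\<bar> \<le> (LINT z|M. \<bar>f z\<bar>)" by (rule integral_abs_bound)
  also have "\<dots> \<le> (LINT z|M. 1)" using True assms by (intro integral_mono) auto
  finally show ?thesis by (simp add: prob_space[simplified])
qed (simp add: not_integrable_integral_eq)

text \<open>The outer integration, shared by both summands of \<open>A2\<close>: \<open>y\<close> is
  the trajectory \<open>U u\<close>, \<open>h\<close> an inner integral as a function of the
  capital, and \<open>w\<close> the probability that the other kind of arrival has not yet occurred.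
  The pointwise bound is multiplied by \<open>w\<close> and integrated.\<close>

lemma (in real_distribution) weighted_integral_lower_bound:
  fixes h y w :: "real \<Rightarrow> real"
  assumes [measurable]: "h \<in> borel_measurable borel" "w \<in> borel_measurable borel"
    and y: "continuous_on {0..} y"
    and h: "\<And>x. \<bar>h x\<bar> \<le> 1" and w: "\<And>t. 0 \<le> w t" "\<And>t. w t \<le> 1" and "0 \<le> b"
    and bound: "\<And>t. 0 \<le> t \<Longrightarrow> 1 - a * exp (- b * t) \<le> h (y t)"
  shows "(LINT t:{0..}|M. w t) - a * (LINT t:{0..}|M. exp (- b * t) * w t)
    \<le> (LINT t:{0..}|M. h (y t) * w t)"
proof -
  \<comment> \<open>\<open>y\<close> is controlled only for nonnegative times. Freezing it at
    \<open>y 0\<close> before time 0 gives a Borel function on the whole line with the same values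
    on \<open>{0..}\<close>.\<close>
  have "continuous_on UNIV (\<lambda>t. y (max 0 t))"
    by (intro continuous_on_compose2[OF y] continuous_intros) auto
  then have [measurable]: "(\<lambda>t. y (max 0 t)) \<in> borel_measurable borel"
    by (rule borel_measurable_continuous_onI)
  have i1: "set_integrable M {0..} w"
    unfolding set_integrable_def using w
    by (intro integrable_const_bound[where B=1]) (auto simp: indicator_def)
  have i2: "set_integrable M {0..} (\<lambda>t. exp (- b * t) * w t)"
    unfolding set_integrable_def using w \<open>0 \<le> b\<close>
    by (intro integrable_const_bound[where B=1]) (auto simp: indicator_def intro!: mult_le_one)
  have "integrable M (\<lambda>t. indicator {0..} t * (h (y (max 0 t)) * w t))"
    using w h by (intro integrable_const_bound[where B=1])
      (auto simp: indicator_def abs_mult intro!: mult_le_one)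
  also have "(\<lambda>t. indicator {0..} t * (h (y (max 0 t)) * w t))
    = (\<lambda>t. indicator {0..} t *\<^sub>R (h (y t) * w t))"
    by (auto simp: indicator_def fun_eq_iff)
  finally have i3: "set_integrable M {0..} (\<lambda>t. h (y t) * w t)"
    unfolding set_integrable_def .
  have "(LINT t:{0..}|M. w t) - a * (LINT t:{0..}|M. exp (- b * t) * w t)
    = (LINT t:{0..}|M. w t - a * (exp (- b * t) * w t))"
    using i1 i2 by (simp add: set_integral_diff)
  also have "\<dots> \<le> (LINT t:{0..}|M. h (y t) * w t)"
  proof (rule set_integral_mono)
    show "set_integrable M {0..} (\<lambda>t. w t - a * (exp (- b * t) * w t))"
      using i1 i2 by (intro set_integral_diff set_integrable_mult_right) auto
    fix t :: real assume "t \<in> {0..}"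
    then have "(1 - a * exp (- b * t)) * w t \<le> h (y t) * w t"
      using bound w by (intro mult_right_mono) auto
    then show "w t - a * (exp (- b * t) * w t) \<le> h (y t) * w t"
      by (simp add: algebra_simps)
  qed (rule i3)
  finally show ?thesis .
qed

text \<open>Links hypothesis (b), where a divergent moment counts as infinity, to the real-valued
  integrals of \<open>A2\<close>, where it would count as 0.\<close>

lemma set_nn_integral_eq_ennreal_set_integral:
  assumes "set_integrable M A f" "\<And>x. x \<in> A \<Longrightarrow> 0 \<le> f x"
  shows "(\<integral>\<^sup>+x\<in>A. ennreal (f x) \<partial>M) = ennreal (LINT x:A|M. f x)"
proof -
  have "(\<integral>\<^sup>+x\<in>A. ennreal (f x) \<partial>M) = (\<integral>\<^sup>+x. ennreal (indicator A x *\<^sub>R f x) \<partial>M)"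
    by (intro nn_integral_cong) (auto simp: indicator_def)
  also have "\<dots> = ennreal (LINT x:A|M. f x)"
    using assms unfolding set_integrable_def set_lebesgue_integral_def
    by (intro nn_integral_eq_integral) (auto simp: indicator_def)
  finally show ?thesis .
qed

lemma set_integral_nonneg':
  fixes f :: "'a \<Rightarrow> real"
  assumes "\<And>x. x \<in> A \<Longrightarrow> 0 \<le> f x"
  shows "0 \<le> (LINT x:A|M. f x)"
  unfolding set_lebesgue_integral_def using assms
  by (intro integral_nonneg_AE) (auto simp: indicator_def)

section \<open>The inequality for \<open>A2\<close> from hypotheses (a) and (b)\<close>

theorem lemma6p5:
  fixes F G Kp Kc c :: "real \<Rightarrow> real" and U :: "real \<Rightarrow> real \<Rightarrow> real"
    and u_star c_star L2 :: real
  assumes "nonneg_cdf F" and "nonneg_cdf G"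
    and "nonneg_cdf Kp" and "nonneg_cdf Kc"
    and "\<forall>t. \<not> (\<not> isCont Kp t \<and> \<not> isCont Kc t)"
    and "\<forall>t\<ge>0. Kp t < 1" and "\<forall>t\<ge>0. Kc t < 1"
    and "\<forall>x\<ge>0. 0 \<le> c x" and "piecewise_continuous c" and "cauchy_flow c U"
    and "u_star \<ge> 0" and "c_star > 0" and "L2 > 0"
    and "\<forall>u\<ge>u_star. \<forall>t\<ge>0. U u t \<ge> u + c_star * t"
    and "(\<integral>\<^sup>+z\<in>{0..}. ennreal (exp (L2 * z)) \<partial>interval_measure F) *
         (\<integral>\<^sup>+t\<in>{0..}. ennreal (exp (- c_star * L2 * t) * (1 - Kp t)) \<partial>interval_measure Kc) +
         (\<integral>\<^sup>+z\<in>{0..}. ennreal (exp (- L2 * z)) \<partial>interval_measure G) *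
         (\<integral>\<^sup>+t\<in>{0..}. ennreal (exp (- c_star * L2 * t) * (1 - Kc t)) \<partial>interval_measure Kp)
         \<le> 1"
    and "((\<lambda>z. exp (L2 * z) * (1 - F z)) \<longlongrightarrow> 0) at_top"
  shows "mono_on {0..} (phi_star L2 u_star) \<and>
         (\<forall>u\<ge>0. 0 \<le> phi_star L2 u_star u \<and> phi_star L2 u_star u \<le> 1) \<and>
         (phi_star L2 u_star \<longlongrightarrow> 1) at_top \<and>
         (\<forall>u\<ge>0. A2 F G Kp Kc U (phi_star L2 u_star) u \<ge> phi_star L2 u_star u)"
proof -
  let ?F = "interval_measure F" and ?G = "interval_measure G"
    and ?P = "interval_measure Kp" and ?C = "interval_measure Kc"
  note F = nonneg_cdf_interval_measure[OF assms(1)]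
    and G = nonneg_cdf_interval_measure[OF assms(2)]
    and P = nonneg_cdf_interval_measure[OF assms(3)]
    and C = nonneg_cdf_interval_measure[OF assms(4)]
  interpret F: real_distribution ?F by (rule F)
  interpret G: real_distribution ?G by (rule G)
  interpret P: real_distribution ?P by (rule P)
  interpret C: real_distribution ?C by (rule C)
  have [measurable]: "Kp \<in> borel_measurable borel" "Kc \<in> borel_measurable borel"
    using P.borel_measurable_cdf C.borel_measurable_cdf P(3) C(3) by simp_all
  have Kp: "0 \<le> Kp t" "Kp t \<le> 1" and Kc: "0 \<le> Kc t" "Kc t \<le> 1" for t
    using P.cdf_nonneg[of t] P.cdf_bounded_prob[of t] C.cdf_nonneg[of t] C.cdf_bounded_prob[of t]
      P(3) C(3) by simp_all
  let ?phi = "phi_star L2 u_star"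
  let ?b = "c_star * L2"
  have b: "0 \<le> ?b" using assms(12,13) by simp
  \<comment> \<open>The four factors of (b) as real numbers. Three have integrands bounded by 1;
    \<open>eF\<close> represents the claim moment only once \<open>intF\<close> is
    established.\<close>
  define ec where "ec = (LINT t:{0..}|?C. exp (- ?b * t) * (1 - Kp t))"
  define ep where "ep = (LINT t:{0..}|?P. exp (- ?b * t) * (1 - Kc t))"
  define eF where "eF = (LINT z:{0..}|?F. exp (L2 * z))"
  define eG where "eG = (LINT z:{0..}|?G. exp (- L2 * z))"
  have nnc: "(\<integral>\<^sup>+t\<in>{0..}. ennreal (exp (- c_star * L2 * t) * (1 - Kp t)) \<partial>?C) = ennreal ec"
    unfolding ec_def minus_mult_left
    using Kp b by (intro set_nn_integral_eq_ennreal_set_integral)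
      (auto simp: set_integrable_def indicator_def intro!: C.integrable_const_bound[where B=1] AE_I2 mult_le_one)
  have nnp: "(\<integral>\<^sup>+t\<in>{0..}. ennreal (exp (- c_star * L2 * t) * (1 - Kc t)) \<partial>?P) = ennreal ep"
    unfolding ep_def minus_mult_left
    using Kc b by (intro set_nn_integral_eq_ennreal_set_integral)
      (auto simp: set_integrable_def indicator_def intro!: P.integrable_const_bound[where B=1] AE_I2 mult_le_one)
  have nnG: "(\<integral>\<^sup>+z\<in>{0..}. ennreal (exp (- L2 * z)) \<partial>?G) = ennreal eG"
    unfolding eG_def using assms(13) by (intro set_nn_integral_eq_ennreal_set_integral)
      (auto simp: set_integrable_def indicator_def intro!: G.integrable_const_bound[where B=1])
  \<comment> \<open>If the integral vanished, so would its integrand almost everywhere, although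
    \<open>Kp t < 1\<close> makes it positive on the half-line carrying \<open>?C\<close>.
    Positivity matters because infinity times 0 is 0 in \<open>ennreal\<close>.\<close>
  have ec_pos: "ennreal ec \<noteq> 0"
  proof
    assume "ennreal ec = 0"
    then have "AE t in ?C. ennreal (exp (- c_star * L2 * t) * (1 - Kp t)) * indicator {0..} t = 0"
      unfolding nnc[symmetric] by (subst (asm) nn_integral_0_iff_AE) auto
    then have "AE t in ?C. False"
      using C(2) by eventually_elim (use assms(6) in \<open>auto simp: ennreal_eq_0_iff mult_le_0_iff not_le\<close>)
    then show False by simp
  qed
  have intF: "set_integrable ?F {0..} (\<lambda>z. exp (L2 * z))"
  proof -
    have "(\<integral>\<^sup>+z\<in>{0..}. ennreal (exp (L2 * z)) \<partial>?F) \<noteq> \<infinity>"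
    proof
      assume "(\<integral>\<^sup>+z\<in>{0..}. ennreal (exp (L2 * z)) \<partial>?F) = \<infinity>"
      with assms(15) ec_pos show False
        unfolding nnc by (simp add: ennreal_top_mult top_add top_unique)
    qed
    also have "(\<integral>\<^sup>+z\<in>{0..}. ennreal (exp (L2 * z)) \<partial>?F)
      = (\<integral>\<^sup>+z. ennreal (norm (indicator {0..} z *\<^sub>R exp (L2 * z))) \<partial>?F)"
      by (intro nn_integral_cong) (auto simp: indicator_def)
    finally show ?thesis
      unfolding set_integrable_def by (intro integrableI_bounded) (auto simp: top.not_eq_extremum)
  qed
  have nnF: "(\<integral>\<^sup>+z\<in>{0..}. ennreal (exp (L2 * z)) \<partial>?F) = ennreal eF"
    unfolding eF_def using intF by (intro set_nn_integral_eq_ennreal_set_integral) auto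
  have nonneg: "0 \<le> ec" "0 \<le> ep" "0 \<le> eF" "0 \<le> eG"
    unfolding ec_def ep_def eF_def eG_def using Kp Kc by (auto intro!: set_integral_nonneg')
  have le1: "eF * ec + eG * ep \<le> 1"
    using assms(15) nonneg unfolding nnc nnp nnF nnG
    by (simp flip: ennreal_mult ennreal_plus add: ennreal_le_1)
  have split1: "(LINT t:{0..}|?C. 1 - Kp t) + (LINT t:{0..}|?P. 1 - Kc t) = 1"
    using real_distribution_no_ties[OF P(1,2) C(1,2)] assms(5) P(3) C(3) by auto
  \<comment> \<open>The inner integrals of \<open>A2\<close> as functions of the capital
    \<open>x\<close> just before the arrival, so that the outer integrands become compositions with
    the trajectory.\<close>
  define hF where "hF x = (LINT z:{0..x}|?F. ?phi (x - z))" for x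
  define hG where "hG x = (LINT z:{0..}|?G. ?phi (x + z))" for x
  have hF_meas: "hF \<in> borel_measurable borel"
  proof -
    \<comment> \<open>Moving the variable endpoint \<open>x\<close> into the integrand leaves an
      integral with a parameter, whose integrand is jointly measurable in \<open>x\<close> and
      \<open>z\<close>.\<close>
    have "hF = (\<lambda>x. LINT z|?F. (if 0 \<le> z \<and> z \<le> x then ?phi (x - z) else 0))"
      unfolding hF_def set_lebesgue_integral_def
      by (intro ext Bochner_Integration.integral_cong) (auto simp: indicator_def)
    also have "\<dots> \<in> borel_measurable borel" by measurable
    finally show ?thesis .
  qed
  have hG_meas: "hG \<in> borel_measurable borel"
    unfolding hG_def set_lebesgue_integral_def by measurable
  have hF_abs: "\<bar>hF x\<bar> \<le> 1" and hG_abs: "\<bar>hG x\<bar> \<le> 1" for x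
    unfolding hF_def hG_def set_lebesgue_integral_def
    using phi_star_nonneg phi_star_le_1
    by (intro F.integral_abs_le_1 G.integral_abs_le_1; simp add: indicator_def)+
  have hF_nn: "0 \<le> hF x" and hG_nn: "0 \<le> hG x" for x
    unfolding hF_def hG_def by (auto intro!: set_integral_nonneg' phi_star_nonneg)
  have A2: "A2 F G Kp Kc U ?phi u = (LINT t:{0..}|?C. hF (U u t) * (1 - Kp t)) +
      (LINT t:{0..}|?P. hG (U u t) * (1 - Kc t))" for u
    unfolding A2_def hF_def hG_def ..
  have main: "?phi u \<le> A2 F G Kp Kc U ?phi u" if "0 \<le> u" for u
  proof (cases "u_star \<le> u")
    \<comment> \<open>Below \<open>u_star\<close> the function \<open>?phi\<close> is 0, and
      \<open>A2\<close> maps nonnegative functions to nonnegative values.\<close>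
    case False
    then have "?phi u = 0"
      using assms(13) by (simp add: phi_star_def mult_nonneg_nonpos)
    moreover have "0 \<le> A2 F G Kp Kc U ?phi u"
      unfolding A2 using hF_nn hG_nn Kp Kc
      by (intro add_nonneg_nonneg set_integral_nonneg' mult_nonneg_nonneg) auto
    ultimately show ?thesis by simp
  next
    case True
    let ?a = "exp (- L2 * (u - u_star))"
    have cont: "continuous_on {0..} (U u)"
      using assms(10) that unfolding cauchy_flow_def cauchy_solution_def by blast
    \<comment> \<open>Hypothesis (a) enters here: linear growth of the capital becomes exponential
      decay in time at rate \<open>?b\<close>, and the capital stays above \<open>u_star\<close>, as
      the claim bound requires.\<close>
    have decay: "exp (- L2 * (U u t - u_star)) \<le> ?a * exp (- ?b * t)" and ge: "u_star \<le> U u t"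
      if "0 \<le> t" for t
    proof -
      have U: "u + c_star * t \<le> U u t" using assms(14) True that by blast
      then show "u_star \<le> U u t"
        using True assms(12) that by (smt (verit) mult_nonneg_nonneg)
      have "L2 * (u + c_star * t - u_star) \<le> L2 * (U u t - u_star)"
        using U assms(13) by (intro mult_left_mono) auto
      then show "exp (- L2 * (U u t - u_star)) \<le> ?a * exp (- ?b * t)"
        unfolding exp_add[symmetric] by (simp add: algebra_simps)
    qed
    \<comment> \<open>The claim summand: the inner bound at capital \<open>U u t\<close>, weakened
      by \<open>decay\<close>, is the hypothesis of the outer bound with coefficient
      \<open>?a * eF\<close>. The premium summand follows the same way with
      \<open>?a * eG\<close>.\<close>
    have "(LINT t:{0..}|?C. 1 - Kp t) - ?a * eF * (LINT t:{0..}|?C. exp (- ?b * t) * (1 - Kp t))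
      \<le> (LINT t:{0..}|?C. hF (U u t) * (1 - Kp t))"
    proof (rule C.weighted_integral_lower_bound[OF hF_meas _ cont hF_abs _ _ b])
      fix t :: real assume t: "0 \<le> t"
      have "1 - exp (- L2 * (U u t - u_star)) * eF \<le> hF (U u t)"
        unfolding hF_def eF_def using assms(11,13) ge[OF t]
        by (intro F.claim_integral_lower_bound[OF F(2) intF]) auto
      moreover have "exp (- L2 * (U u t - u_star)) * eF \<le> ?a * exp (- ?b * t) * eF"
        using decay[OF t] nonneg by (intro mult_right_mono)
      ultimately show "1 - ?a * eF * exp (- ?b * t) \<le> hF (U u t)"
        by (simp add: mult_ac)
    qed (use Kp in auto)
    moreover have "(LINT t:{0..}|?P. 1 - Kc t) - ?a * eG * (LINT t:{0..}|?P. exp (- ?b * t) * (1 - Kc t))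
      \<le> (LINT t:{0..}|?P. hG (U u t) * (1 - Kc t))"
    proof (rule P.weighted_integral_lower_bound[OF hG_meas _ cont hG_abs _ _ b])
      fix t :: real assume t: "0 \<le> t"
      have "1 - exp (- L2 * (U u t - u_star)) * eG \<le> hG (U u t)"
        unfolding hG_def eG_def using assms(13)
        by (intro G.premium_integral_lower_bound[OF G(2)]) auto
      moreover have "exp (- L2 * (U u t - u_star)) * eG \<le> ?a * exp (- ?b * t) * eG"
        using decay[OF t] nonneg by (intro mult_right_mono)
      ultimately show "1 - ?a * eG * exp (- ?b * t) \<le> hG (U u t)"
        by (simp add: mult_ac)
    qed (use Kc in auto)
    \<comment> \<open>Adding the two bounds, \<open>split1\<close> turns the constant parts into 1,
      and \<open>le1\<close> then bounds the subtracted term by \<open>?a\<close>, leaving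
      \<open>1 - ?a\<close>, the value of \<open>?phi\<close> at \<open>u\<close>.\<close>
    ultimately have "1 - ?a * (eF * ec + eG * ep) \<le> A2 F G Kp Kc U ?phi u"
      unfolding A2 using split1 by (fold ec_def ep_def) (simp add: algebra_simps)
    moreover have "?a * (eF * ec + eG * ep) \<le> ?a * 1"
      using le1 by (intro mult_left_mono) auto
    moreover have "?phi u = 1 - ?a"
      using True assms(13) by (simp add: phi_star_def)
    ultimately show ?thesis by linarith
  qed
  show ?thesis
    using mono_phi_star[of L2 u_star] tendsto_phi_star[of L2 u_star] assms(13) main
      phi_star_nonneg phi_star_le_1
    by (auto intro: mono_on_subset)
qed

end
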